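(* Let $p$ be a prime, $n$ a positive integer, $q=p^n$, and let $F:\mathbb{F}_q\to\mathbb{F}_q$ be a planar function. Then for all non-zero functions $G:\mathbb{F}_q\to\mathbb{F}_q$, \[ \deg_{\mathrm{alg}}(G\circ F)-\deg_{\mathrm{alg}}(G)\le \frac{n(p-1)}{2}. \]
   Context: A function $F:\mathbb{F}_q\to\mathbb{F}_q$ is planar if for every non-zero $\alpha\in\mathbb{F}_q$ the map $x\mapsto F(x+\alpha)-F(x)-F(\alpha)$ is a permutation of $\mathbb{F}_q$. For a non-negative integer $e$, $s_p(e)$ denotes the sum of the digits of the base-$p$ representation of $e$. Every function $H:\mathbb{F}_q\to\mathbb{F}_q$ has a unique interpolating polynomial $\sum_{i=0}^{q-1}a_iX^i$ with $a_i\in\mathbb{F}_q$; for non-zero $H$, its algebraic degree is $\deg_{\mathrm{alg}}(H)=\max\{s_p(i)\mid a_i\neq 0\}$. *)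

theory Defs
  imports
    "HOL-Computational_Algebra.Computational_Algebra"
    "HOL-Library.Cardinality"
begin

definition planar :: "('a :: {field, finite} \<Rightarrow> 'a) \<Rightarrow> bool" where
  "planar F \<longleftrightarrow> (\<forall>\<alpha>. \<alpha> \<noteq> 0 \<longrightarrow> bij (\<lambda>x. F (x + \<alpha>) - F x - F \<alpha>))"

(* The digit of e at position i in base p is (e div p ^ i) mod p; for p \<ge> 2 the digits at
   positions i > e all vanish, since e < p ^ i. *)
definition digit_sum :: "nat \<Rightarrow> nat \<Rightarrow> nat" where
  "digit_sum p e = (\<Sum>i\<le>e. (e div p ^ i) mod p)"

definition interp_poly :: "('a :: {field, finite} \<Rightarrow> 'a) \<Rightarrow> 'a poly" where
  "interp_poly H = (THE P. degree P < CARD('a) \<and> (\<forall>x. poly P x = H x))"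

lemma interp_poly_ex1:
  fixes H :: "'a :: {field, finite} \<Rightarrow> 'a"
  shows "\<exists>!P. degree P < CARD('a) \<and> (\<forall>x. poly P x = H x)"
proof (rule ex_ex1I)
  define L :: "'a \<Rightarrow> 'a poly" where "L a = (\<Prod>b\<in>UNIV - {a}. [:-b, 1:])" for a
  define P where "P = (\<Sum>a\<in>UNIV. smult (H a / poly (L a) a) (L a))"
  have L_off: "poly (L a) x = 0" if "x \<noteq> a" for a x
    using that by (auto simp: L_def poly_prod)
  have L_diag: "poly (L a) a \<noteq> 0" for a
    by (auto simp: L_def poly_prod)
  have "degree (L a) = CARD('a) - 1" for a
    by (simp add: L_def degree_prod_sum_eq card_Diff_singleton)
  hence "degree P \<le> CARD('a) - 1"
    unfolding P_def by (intro degree_sum_le) (auto intro: order.trans[OF degree_smult_le])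
  moreover have "CARD('a) > 0" by simp
  ultimately have "degree P < CARD('a)" by linarith
  moreover have "poly P x = H x" for x
  proof -
    have "poly P x = (\<Sum>a\<in>UNIV. if a = x then H x else 0)"
      unfolding P_def poly_sum by (intro sum.cong) (auto simp: L_off L_diag)
    thus ?thesis by simp
  qed
  ultimately show "\<exists>P. degree P < CARD('a) \<and> (\<forall>x. poly P x = H x)" by blast
next
  fix P Q :: "'a poly"
  assume P: "degree P < CARD('a) \<and> (\<forall>x. poly P x = H x)"
    and Q: "degree Q < CARD('a) \<and> (\<forall>x. poly Q x = H x)"
  show "P = Q"
  proof (rule ccontr)
    assume "P \<noteq> Q"
    hence "card {x. poly (P - Q) x = 0} \<le> degree (P - Q)"
      by (intro card_poly_roots_bound) simp
    moreover have "{x. poly (P - Q) x = 0} = UNIV" using P Q by simp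
    moreover have "degree (P - Q) < CARD('a)" using P Q by (intro degree_diff_less) auto
    ultimately show False by simp
  qed
qed

(* The zero function, whose algebraic degree is left undefined in the literature or set to
   -\<infinity>, gets degree 0 here. *)
definition alg_degree :: "nat \<Rightarrow> ('a :: {field, finite} \<Rightarrow> 'a) \<Rightarrow> nat" where
  "alg_degree p H =
     (if H = (\<lambda>_. 0) then 0
      else Max {digit_sum p i | i. coeff (interp_poly H) i \<noteq> 0})"

end

theory Submission
  imports Defs "HOL-Number_Theory.Cong"
begin

text \<open>Let \<open>q = p ^ n\<close>. A coefficient of \<open>G \<circ> F\<close> of digit sum \<open>s\<close> is, up to sign, a combination of sums
  \<open>\<Sum>x. x ^ A * F x ^ B\<close> in which \<open>A\<close> has digit sum \<open>n(p - 1) - s\<close> and \<open>B\<close> has digit sum at most the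
  algebraic degree of \<open>G\<close>. So it suffices that such a sum vanishes when the digit sums of \<open>A\<close> and
  \<open>B\<close> add up to \<open>d < n(p - 1) / 2\<close>. As \<open>x ^ (p ^ j)\<close> is a linear combination of the functions
  \<open>x \<mapsto> tr (b x)\<close>, this reduces to sums of products of \<open>d\<close> traces \<open>tr (a x + b F x)\<close>.

  Let \<open>\<zeta>\<close> be a primitive \<open>p\<close>-th root of unity and \<open>\<pi> = \<zeta> - 1\<close>. By planarity every sum
  \<open>\<Sum>x. \<zeta> ^ tr (a x + b F x)\<close> with \<open>b \<noteq> 0\<close> has squared absolute value \<open>q\<close>, which is \<open>\<pi> ^ (n(p - 1))\<close>
  up to a unit; hence it is divisible by \<open>\<pi> ^ (d + 1)\<close> (for \<open>b = 0\<close> it is \<open>0\<close> or \<open>q\<close>). The sum over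
  \<open>x\<close> of the product of the \<open>d\<close> factors \<open>\<zeta> ^ tr (a x + b F x) - 1\<close> is a signed sum of such
  character sums, and is also \<open>\<pi> ^ d\<close> times the required sum of products of traces, modulo
  \<open>\<pi> ^ (d + 1)\<close>. So the latter is divisible by \<open>\<pi>\<close>, hence by \<open>p\<close>.

  The ring \<open>\<int>[\<zeta>]\<close> is represented by \<open>\<int>[X]\<close> with congruences modulo \<open>1 + X + \<dots> + X ^ (p - 1)\<close>.\<close>

section \<open>The ring \<open>\<int>[X]\<close> modulo \<open>1 + X + \<dots> + X ^ (p - 1)\<close>\<close>

abbreviation X_poly :: "int poly" where "X_poly \<equiv> [:0, 1:]"

definition pi_poly :: "int poly" where "pi_poly = X_poly - 1"

text \<open>For prime \<open>p\<close> this is the \<open>p\<close>-th cyclotomic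
  polynomial.\<close>

definition cyc_poly :: "nat \<Rightarrow> int poly" where "cyc_poly p = (\<Sum>i<p. X_poly ^ i)"

definition in_pi_power :: "nat \<Rightarrow> nat \<Rightarrow> int poly \<Rightarrow> bool" where
  "in_pi_power p k f \<longleftrightarrow> (\<exists>g. cyc_poly p dvd f - pi_poly ^ k * g)"

lemma poly_X_power_1 [simp]: "poly (X_poly ^ k) 1 = 1"
  by (simp add: poly_power)

lemma X_power_diff_1: "X_poly ^ k - 1 = pi_poly * (\<Sum>j<k. X_poly ^ j)"
  unfolding pi_poly_def by (rule power_diff_1_eq)

lemma poly_pi_1 [simp]: "poly pi_poly 1 = 0"
  by (simp add: pi_poly_def)

lemma pi_poly_nonzero [simp]: "pi_poly \<noteq> 0"
  by (simp add: pi_poly_def one_pCons)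

text \<open>Evaluation at 1 is reduction modulo \<pi>. As \<open>cyc_poly p\<close> has the value
  \<open>p\<close> there, \<open>poly f 1\<close> modulo \<open>p\<close> is the residue of
  \<open>f\<close> in \<int>[\<zeta>]/(\<pi>).\<close>

lemma pi_dvd_iff: "pi_poly dvd f \<longleftrightarrow> poly f 1 = 0"
  by (simp add: pi_poly_def one_pCons poly_eq_0_iff_dvd)

lemma poly_cyc_1 [simp]: "poly (cyc_poly p) 1 = int p"
  by (simp add: cyc_poly_def poly_sum poly_power)

lemma pi_mult_cyc: "pi_poly * cyc_poly p = X_poly ^ p - 1"
  by (simp add: X_power_diff_1 cyc_poly_def)

lemma cyc_dvd_X_power_diff:
  assumes "[a = b] (mod p)"
  shows "cyc_poly p dvd X_poly ^ a - X_poly ^ b"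
  using assms
proof (induction a b rule: linorder_wlog)
  case (le a b)
  hence "[b = a] (mod p)" by (simp only: cong_sym)
  then obtain c where c: "b = c * p + a"
    using cong_le_nat [OF le(1)] by blast
  have "(X_poly ^ p) ^ c - 1 = pi_poly * cyc_poly p * (\<Sum>j<c. (X_poly ^ p) ^ j)"
    unfolding pi_mult_cyc by (rule power_diff_1_eq)
  hence "cyc_poly p dvd X_poly ^ a * ((X_poly ^ p) ^ c - 1)"
    by simp
  also have "X_poly ^ a * ((X_poly ^ p) ^ c - 1) = X_poly ^ b - X_poly ^ a"
    by (simp add: c power_add right_diff_distrib mult_ac flip: power_mult)
  finally show ?case by (subst dvd_minus_iff [symmetric]) simp
next
  case (sym a b)
  hence "cyc_poly p dvd X_poly ^ b - X_poly ^ a" by (simp only: cong_sym)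
  thus ?case by (subst dvd_minus_iff [symmetric]) simp
qed

text \<open>Evaluating \<open>pi_poly * f = cyc_poly p * c\<close> at 1 forces
  \<open>poly c 1 = 0\<close>, so \<pi> divides \<open>c\<close> and cancels in \<int>[X].\<close>

lemma cyc_dvd_pi_mult_cancel:
  assumes "p > 0" "cyc_poly p dvd pi_poly * f"
  shows "cyc_poly p dvd f"
proof -
  obtain c where c: "pi_poly * f = cyc_poly p * c"
    using assms by (elim dvdE)
  have "int p * poly c 1 = poly (pi_poly * f) 1"
    unfolding c by simp
  hence "poly c 1 = 0"
    using assms(1) by simp
  then obtain d where "c = pi_poly * d"
    unfolding pi_dvd_iff [symmetric] by (elim dvdE)
  with c have "f = cyc_poly p * d" by simp
  thus ?thesis by simp
qed

lemma cyc_dvd_pi_power_mult_cancel: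
  assumes "p > 0" "cyc_poly p dvd pi_poly ^ k * f"
  shows "cyc_poly p dvd f"
  using assms by (induction k) (auto simp: mult.assoc dest: cyc_dvd_pi_mult_cancel)

section \<open>The ideals (\<pi> ^ k)\<close>

lemma in_pi_power_0 [simp]: "in_pi_power p 0 f"
  unfolding in_pi_power_def by (rule exI [of _ f]) simp

lemma in_pi_power_pi: "in_pi_power p k (pi_poly ^ k)"
  unfolding in_pi_power_def by (rule exI [of _ 1]) simp

lemma in_pi_power_cong:
  assumes "cyc_poly p dvd f - g" "in_pi_power p k g"
  shows "in_pi_power p k f"
proof -
  obtain h where "cyc_poly p dvd g - pi_poly ^ k * h"
    using assms(2) unfolding in_pi_power_def by blast
  hence "cyc_poly p dvd (f - g) + (g - pi_poly ^ k * h)"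
    using assms(1) by (intro dvd_add)
  thus ?thesis unfolding in_pi_power_def by (intro exI [of _ h]) simp
qed

lemma in_pi_power_cyc_dvd: "cyc_poly p dvd f \<Longrightarrow> in_pi_power p k f"
  unfolding in_pi_power_def by (rule exI [of _ 0]) simp

lemma in_pi_power_add:
  assumes "in_pi_power p k f" "in_pi_power p k g"
  shows "in_pi_power p k (f + g)"
proof -
  obtain a b where "cyc_poly p dvd f - pi_poly ^ k * a" "cyc_poly p dvd g - pi_poly ^ k * b"
    using assms unfolding in_pi_power_def by blast
  hence "cyc_poly p dvd (f - pi_poly ^ k * a) + (g - pi_poly ^ k * b)"
    by (rule dvd_add)
  thus ?thesis
    unfolding in_pi_power_def by (intro exI [of _ "a + b"]) (simp add: algebra_simps)
qed

lemma in_pi_power_mult: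
  assumes "in_pi_power p k f" "in_pi_power p l g"
  shows "in_pi_power p (k + l) (f * g)"
proof -
  obtain a b where ab: "cyc_poly p dvd f - pi_poly ^ k * a" "cyc_poly p dvd g - pi_poly ^ l * b"
    using assms unfolding in_pi_power_def by blast
  have "f * g - pi_poly ^ (k + l) * (a * b) =
      (f - pi_poly ^ k * a) * g + pi_poly ^ k * a * (g - pi_poly ^ l * b)"
    by (simp add: algebra_simps power_add)
  hence "cyc_poly p dvd f * g - pi_poly ^ (k + l) * (a * b)"
    using ab by (metis dvd_add dvd_mult dvd_mult2)
  thus ?thesis unfolding in_pi_power_def by blast
qed

lemma in_pi_power_mult_left: "in_pi_power p k g \<Longrightarrow> in_pi_power p k (f * g)"
  using in_pi_power_mult [of p 0 f k g] by simp

lemma in_pi_power_diff: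
  "in_pi_power p k f \<Longrightarrow> in_pi_power p k g \<Longrightarrow> in_pi_power p k (f - g)"
  using in_pi_power_add [of p k f "- 1 * g"] in_pi_power_mult_left [of p k g "- 1"] by simp

lemma in_pi_power_sum:
  "(\<And>x. x \<in> A \<Longrightarrow> in_pi_power p k (f x)) \<Longrightarrow> in_pi_power p k (sum f A)"
  by (induction A rule: infinite_finite_induct) (auto simp: in_pi_power_add in_pi_power_cyc_dvd)

lemma in_pi_power_mono:
  assumes "in_pi_power p l f" "k \<le> l"
  shows "in_pi_power p k f"
proof -
  obtain a where "cyc_poly p dvd f - pi_poly ^ l * a"
    using assms unfolding in_pi_power_def by blast
  moreover have "pi_poly ^ l * a = pi_poly ^ k * (pi_poly ^ (l - k) * a)"
    using assms(2) by (simp flip: power_add mult.assoc)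
  ultimately show ?thesis unfolding in_pi_power_def by metis
qed

text \<open>Since \<open>cyc_poly p\<close> has the value \<open>p\<close> at 1, subtracting a
  constant multiple of it from \<open>g\<close> makes the value at 1 vanish, and a further factor
  \<pi> splits off.\<close>

lemma in_pi_power_SucI:
  assumes "cyc_poly p dvd f - pi_poly ^ k * g" "int p dvd poly g 1"
  shows "in_pi_power p (Suc k) f"
proof -
  obtain r where r: "poly g 1 = int p * r"
    using assms(2) by (elim dvdE)
  have "pi_poly dvd g - cyc_poly p * [:r:]"
    unfolding pi_dvd_iff by (simp add: r)
  then obtain h where h: "g - cyc_poly p * [:r:] = pi_poly * h"
    by (elim dvdE)
  have "f - pi_poly ^ Suc k * h = f - pi_poly ^ k * (pi_poly * h)"
    by (simp add: mult_ac)
  also have "\<dots> = (f - pi_poly ^ k * g) + cyc_poly p * ([:r:] * pi_poly ^ k)"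
    unfolding h [symmetric]
    by (simp add: right_diff_distrib mult_ac del: mult_pCons_right mult_pCons_left)
  also have "cyc_poly p dvd \<dots>"
    using assms(1) by (intro dvd_add dvd_triv_left)
  finally show ?thesis unfolding in_pi_power_def by blast
qed

text \<open>Cancelling \<pi> ^ k leaves \<open>g\<close> congruent to a multiple of \<pi>;
  evaluation at 1 turns this into divisibility by \<open>p\<close>.\<close>

lemma in_pi_power_prime_dvd:
  assumes "p > 0" "in_pi_power p l (pi_poly ^ k * g)" "k < l"
  shows "int p dvd poly g 1"
proof -
  have "in_pi_power p (Suc k) (pi_poly ^ k * g)"
    using assms in_pi_power_mono by (metis Suc_leI)
  then obtain a where "cyc_poly p dvd pi_poly ^ k * g - pi_poly ^ Suc k * a"
    unfolding in_pi_power_def by blast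
  hence "cyc_poly p dvd pi_poly ^ k * (g - pi_poly * a)"
    by (simp add: algebra_simps)
  hence "cyc_poly p dvd g - pi_poly * a"
    using assms(1) by (rule cyc_dvd_pi_power_mult_cancel [rotated])
  then obtain c where c: "g - pi_poly * a = cyc_poly p * c"
    by (elim dvdE)
  have "poly g 1 = poly (g - pi_poly * a) 1" by simp
  also have "\<dots> = int p * poly c 1" unfolding c by simp
  finally show ?thesis by simp
qed

text \<open>Divide \<open>(pi_poly + 1) ^ p - 1\<close> by \<pi>. For prime \<open>p\<close> the
  expansion is of Eisenstein type, with constant term \<open>p\<close> and leading coefficient
  1.\<close>

lemma cyc_poly_pi_expansion: "cyc_poly p = (\<Sum>k<p. of_nat (p choose Suc k) * pi_poly ^ k)"
proof -
  have "pi_poly * cyc_poly p = (pi_poly + 1) ^ p - 1"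
    unfolding pi_mult_cyc by (simp add: pi_poly_def)
  also have "(pi_poly + 1) ^ p = (\<Sum>k\<le>p. of_nat (p choose k) * pi_poly ^ k)"
    by (simp add: binomial_ring)
  also have "\<dots> = 1 + (\<Sum>k<p. of_nat (p choose Suc k) * pi_poly ^ Suc k)"
    by (subst sum.atMost_shift) simp
  also have "\<dots> - 1 = pi_poly * (\<Sum>k<p. of_nat (p choose Suc k) * pi_poly ^ k)"
    by (simp add: sum_distrib_left mult_ac)
  finally show ?thesis by simp
qed

text \<open>Modulo \<open>cyc_poly p\<close>, \<open>p\<close> is minus the other terms of the
  expansion. In the induction the inner ones, multiples of \<open>p * pi_poly\<close>, gain one
  power of \<pi>; the last one is \<pi> ^ (p - 1).\<close>

lemma in_pi_power_prime:
  assumes "prime p" "k \<le> p - 1"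
  shows "in_pi_power p k (of_nat p)"
  using assms(2)
proof (induction k)
  case (Suc k)
  have p: "p > 1" using assms(1) by (rule prime_gt_1_nat)
  define S where "S = (\<Sum>j\<in>{0<..<p}. of_nat (p choose Suc j) * pi_poly ^ j)"
  have "{..<p} = insert 0 {0<..<p}" using p by auto
  hence cyc: "cyc_poly p = of_nat p + S"
    unfolding cyc_poly_pi_expansion S_def by simp
  have "in_pi_power p (Suc k) S"
    unfolding S_def
  proof (rule in_pi_power_sum)
    fix j assume j: "j \<in> {0<..<p}"
    show "in_pi_power p (Suc k) (of_nat (p choose Suc j) * pi_poly ^ j)"
    proof (cases "Suc j = p")
      case True
      hence "Suc k \<le> j" using Suc.prems by simp
      thus ?thesis
        by (intro in_pi_power_mult_left in_pi_power_mono [OF in_pi_power_pi])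
    next
      case False
      hence "p dvd p choose Suc j"
        using assms(1) j by (intro dvd_choose_prime) auto
      then obtain c where "p choose Suc j = p * c" by (elim dvdE)
      hence "of_nat (p choose Suc j) * pi_poly ^ j = (of_nat c * pi_poly ^ (j - 1)) * (of_nat p * pi_poly ^ 1)"
        using j by (simp add: mult_ac flip: power_Suc)
      moreover have "in_pi_power p (k + 1) (of_nat p * pi_poly ^ 1)"
        using Suc by (intro in_pi_power_mult in_pi_power_pi) auto
      ultimately show ?thesis by (metis Suc_eq_plus1 in_pi_power_mult_left)
    qed
  qed
  hence "in_pi_power p (Suc k) (cyc_poly p - S)"
    by (intro in_pi_power_diff in_pi_power_cyc_dvd [OF dvd_refl])
  thus ?case by (simp add: cyc)
qed simp

lemma in_pi_power_prime_power:
  assumes "prime p"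
  shows "in_pi_power p (n * (p - 1)) (of_nat p ^ n)"
proof (induction n)
  case (Suc n)
  show ?case
    using in_pi_power_mult [OF in_pi_power_prime [OF assms order.refl] Suc] by simp
qed simp

section \<open>Complex conjugation, given by \<zeta> \<mapsto> \<zeta> ^ (p - 1), and norms\<close>

definition conj_poly :: "nat \<Rightarrow> int poly \<Rightarrow> int poly" where
  "conj_poly p f = pcompose f (X_poly ^ (p - 1))"

lemma poly_conj_1 [simp]: "poly (conj_poly p f) 1 = poly f 1"
  by (simp add: conj_poly_def poly_pcompose)

lemma pcompose_power: "pcompose (f ^ k) g = pcompose f g ^ k" for f g :: "'a :: comm_semiring_1 poly"
  by (induction k) (simp_all add: pcompose_mult pcompose_1)

lemma conj_X_power: "conj_poly p (X_poly ^ k) = X_poly ^ ((p - 1) * k)"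
  by (simp add: conj_poly_def pcompose_power pcompose_pCons power_mult)

lemma conj_sum: "conj_poly p (sum f A) = (\<Sum>x\<in>A. conj_poly p (f x))"
  by (simp add: conj_poly_def pcompose_sum)

lemma conj_pi: "conj_poly p pi_poly = pi_poly * (\<Sum>j<p - 1. X_poly ^ j)"
  by (simp add: conj_poly_def pi_poly_def pcompose_diff pcompose_pCons pcompose_1 power_diff_1_eq)

text \<open>Makes conjugation well defined modulo \<open>cyc_poly p\<close>: multiplication by
  \<open>p - 1\<close> permutes the exponents modulo \<open>p\<close>.\<close>

lemma cyc_dvd_conj_cyc:
  assumes "p > 1"
  shows "cyc_poly p dvd conj_poly p (cyc_poly p)"
proof -
  have inj: "inj_on (\<lambda>i. (p - 1) * i mod p) {..<p}"
  proof (rule inj_onI)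
    fix i j assume ij: "i \<in> {..<p}" "j \<in> {..<p}" "(p - 1) * i mod p = (p - 1) * j mod p"
    have "coprime (p - 1) p" using assms by (intro coprime_diff_one_left_nat) simp
    hence "[i = j] (mod p)"
      using iffD1 [OF cong_mult_lcancel_nat, of "p - 1" p i j] ij(3) unfolding cong_def by blast
    thus "i = j" using ij by (simp add: cong_def)
  qed
  have img: "(\<lambda>i. (p - 1) * i mod p) ` {..<p} = {..<p}"
    using inj assms by (intro card_subset_eq) (auto simp: card_image)
  have "cyc_poly p = (\<Sum>i<p. X_poly ^ ((p - 1) * i mod p))"
    using sum.reindex [OF inj, of "\<lambda>i. X_poly ^ i"] unfolding img cyc_poly_def o_def .
  moreover have "conj_poly p (cyc_poly p) = (\<Sum>i<p. X_poly ^ ((p - 1) * i))"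
    by (simp add: cyc_poly_def conj_sum conj_X_power)
  ultimately have "conj_poly p (cyc_poly p) - cyc_poly p =
      (\<Sum>i<p. X_poly ^ ((p - 1) * i) - X_poly ^ ((p - 1) * i mod p))"
    by (simp add: sum_subtractf)
  also have "cyc_poly p dvd \<dots>"
    by (intro dvd_sum cyc_dvd_X_power_diff) simp
  finally show ?thesis using dvd_add [OF _ dvd_refl] by fastforce
qed

text \<open>The ideal \<open>(\<pi>)\<close> is invariant under conjugation, so \<open>f\<close> and its conjugate are divisible by the same
  powers of \<open>\<pi>\<close>; since \<open>p\<close> is an associate of \<open>\<pi> ^ (p - 1)\<close>, half of the total \<open>n(p - 1)\<close> falls on \<open>f\<close>.\<close>

lemma in_pi_power_of_norm:
  assumes p: "prime p" and norm: "cyc_poly p dvd f * conj_poly p f - of_nat p ^ n"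
    and k: "2 * k < n * (p - 1) + 2"
  shows "in_pi_power p k f"
  using k
proof (induction k)
  case (Suc k)
  have p1: "p > 1" using p by (rule prime_gt_1_nat)
  have p': "prime (int p)" using p by simp
  obtain g where g: "cyc_poly p dvd f - pi_poly ^ k * g"
    using Suc unfolding in_pi_power_def by auto
  \<comment> \<open>The conjugate of \<pi> is \<pi> times this geometric sum, so the conjugate of
    \<open>f\<close> is congruent to \<pi> ^ k times \<open>g'\<close>. At 1, \<open>g'\<close> has
    the value \<open>(p - 1) ^ k * poly g 1\<close>.\<close>
  define g' where "g' = (\<Sum>j<p - 1. X_poly ^ j) ^ k * conj_poly p g"
  obtain c where c: "f - pi_poly ^ k * g = cyc_poly p * c"
    using g by (elim dvdE)
  have "conj_poly p (f - pi_poly ^ k * g) = conj_poly p f - conj_poly p pi_poly ^ k * conj_poly p g"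
    by (simp add: conj_poly_def pcompose_diff pcompose_mult pcompose_power)
  hence "conj_poly p f - pi_poly ^ k * g' = conj_poly p (f - pi_poly ^ k * g)"
    by (simp add: g'_def conj_pi power_mult_distrib mult_ac)
  also have "\<dots> = conj_poly p (cyc_poly p) * conj_poly p c"
    by (simp add: c conj_poly_def pcompose_mult)
  finally have g': "cyc_poly p dvd conj_poly p f - pi_poly ^ k * g'"
    using cyc_dvd_conj_cyc [OF p1] by simp
  have "pi_poly ^ (2 * k) * (g * g') - of_nat p ^ n =
      (f * conj_poly p f - of_nat p ^ n) - (f - pi_poly ^ k * g) * conj_poly p f
      - (pi_poly ^ k * g) * (conj_poly p f - pi_poly ^ k * g')"
    by (simp add: algebra_simps power_mult power2_eq_square)
  also have "cyc_poly p dvd \<dots>"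
    by (rule dvd_diff [OF dvd_diff [OF norm dvd_mult2 [OF g]] dvd_mult [OF g']])
  finally have "in_pi_power p (n * (p - 1)) (pi_poly ^ (2 * k) * (g * g'))"
    using in_pi_power_cong in_pi_power_prime_power [OF p] by blast
  \<comment> \<open>The bound on \<open>Suc k\<close> amounts to \<open>2 * k < n * (p - 1)\<close>,
    so a factor \<pi> is left in \<open>g * g'\<close>.\<close>
  hence "int p dvd poly (g * g') 1"
    using Suc.prems p1 by (intro in_pi_power_prime_dvd [of p "n * (p - 1)" "2 * k"]) auto
  hence "int p dvd (poly g 1)\<^sup>2 * int (p - 1) ^ k"
    by (simp add: g'_def poly_power poly_sum power2_eq_square mult_ac)
  moreover have "\<not> int p dvd int (p - 1) ^ k"
  proof
    assume "int p dvd int (p - 1) ^ k"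
    hence "p dvd p - 1"
      using prime_dvd_power [OF p'] int_dvd_int_iff by blast
    thus False using p1 by (auto dest: dvd_imp_le)
  qed
  ultimately have "int p dvd poly g 1"
    using prime_dvd_power [OF p'] by (auto simp: prime_dvd_mult_iff [OF p'])
  thus ?case using g by (intro in_pi_power_SucI)
qed simp

section \<open>Power sums and the trace of a finite field\<close>

locale finite_field_of_order =
  fixes p n :: nat and field_type :: "'a :: {field, finite} itself"
  assumes prime_p: "prime p" and n_pos: "n > 0" and card_field: "CARD('a) = p ^ n"
begin

lemma p_gt_1: "p > 1"
  using prime_p by (rule prime_gt_1_nat)

lemma p_power_n_gt_1: "p ^ n > 1"
  using p_gt_1 n_pos by (simp only: one_less_power)

text \<open>Replacing x by x + 1 changes the sum of all elements by q times 1.\<close>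

lemma of_nat_card_eq_0: "of_nat (p ^ n) = (0 :: 'a)"
proof -
  have "(\<Sum>x\<in>UNIV. x) = (\<Sum>x\<in>UNIV. x + 1 :: 'a)"
    by (rule sum.reindex_bij_witness [of _ "\<lambda>x. x + 1" "\<lambda>x. x - 1"]) auto
  thus ?thesis by (simp add: sum.distrib card_field)
qed

lemma CHAR_field: "CHAR('a) = p"
proof -
  have "prime CHAR('a)"
    by (intro prime_CHAR_semidom finite_imp_CHAR_pos) auto
  moreover have "CHAR('a) dvd p ^ n"
    using of_nat_card_eq_0 of_nat_eq_0_iff_char_dvd by blast
  ultimately show ?thesis
    using prime_p by (metis prime_dvd_power primes_dvd_imp_eq)
qed

lemma of_nat_p [simp]: "of_nat p = (0 :: 'a)"
  using of_nat_CHAR [where ?'a = 'a] by (simp add: CHAR_field)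

lemma frobenius_add: "(x + y :: 'a) ^ (p ^ j) = x ^ (p ^ j) + y ^ (p ^ j)"
  by (rule freshmans_dream') (simp_all add: CHAR_field prime_p)

lemma frobenius_sum: "(sum f A :: 'a) ^ (p ^ j) = (\<Sum>i\<in>A. f i ^ (p ^ j))"
  by (rule freshmans_dream_sum') (simp_all add: CHAR_field prime_p)

lemma of_nat_power_p: "(of_nat k :: 'a) ^ p = of_nat k"
proof (induction k)
  case (Suc k)
  thus ?case using frobenius_add [of "of_nat k" 1 1] by (simp add: add.commute)
qed (use p_gt_1 in simp)

lemma power_card_minus_1: "x \<noteq> 0 \<Longrightarrow> (x :: 'a) ^ (p ^ n - 1) = 1"
proof -
  assume x: "x \<noteq> 0"
  have "(\<Prod>y\<in>UNIV-{0}. y) = (\<Prod>y\<in>UNIV-{0}. x * y)"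
    by (rule prod.reindex_bij_witness [of _ "\<lambda>y. x * y" "\<lambda>y. y / x"]) (use x in auto)
  also have "\<dots> = x ^ (p ^ n - 1) * (\<Prod>y\<in>UNIV-{0}. y)"
    by (simp add: prod.distrib card_Diff_singleton card_field)
  finally show ?thesis by simp
qed

lemma power_card: "(x :: 'a) ^ (p ^ n) = x"
proof (cases "x = 0")
  case False
  have "x ^ (p ^ n) = x ^ Suc (p ^ n - 1)" using p_gt_1 by simp
  thus ?thesis using power_card_minus_1 [OF False] by simp
qed (use p_gt_1 in simp)

lemma exists_power_neq_1:
  assumes "0 < k" "k < p ^ n - 1"
  shows "\<exists>b :: 'a. b \<noteq> 0 \<and> b ^ k \<noteq> 1"
proof (rule ccontr)
  assume "\<not> ?thesis"
  hence all: "UNIV - {0 :: 'a} \<subseteq> {x. poly (monom 1 k - 1) x = 0}"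
    by (auto simp: poly_monom)
  have deg: "degree (monom 1 k - 1 :: 'a poly) = k"
    using degree_add_eq_left [of "- 1" "monom 1 k :: 'a poly"] assms(1) by (simp add: degree_monom_eq)
  hence nz: "monom 1 k - 1 \<noteq> (0 :: 'a poly)"
    using assms(1) by auto
  have "p ^ n - 1 \<le> card {x :: 'a. poly (monom 1 k - 1) x = 0}"
    using card_mono [OF _ all] by (simp add: card_Diff_singleton card_field)
  also have "\<dots> \<le> k"
    using card_poly_roots_bound [OF nz] by (simp add: deg)
  finally show False using assms(2) by simp
qed

lemma sum_powers_UNIV:
  "(\<Sum>x\<in>UNIV. (x :: 'a) ^ k) = (if k > 0 \<and> p ^ n - 1 dvd k then - 1 else 0)"
proof (cases "p ^ n - 1 dvd k")
  case True
  show ?thesis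
  proof (cases "k = 0")
    case True
    \<comment> \<open>With 0 ^ 0 = 1 all q terms are 1.\<close>
    thus ?thesis using of_nat_card_eq_0 by (simp add: card_field)
  next
    case False
    obtain c where "k = (p ^ n - 1) * c" using \<open>p ^ n - 1 dvd k\<close> by (elim dvdE)
    hence "x ^ k = 1" if "x \<noteq> 0" for x :: 'a
      using power_card_minus_1 [OF that] by (simp add: power_mult)
    hence "(\<Sum>x\<in>UNIV. (x :: 'a) ^ k) = (\<Sum>x\<in>UNIV - {0 :: 'a}. 1)"
      using False by (intro sum.mono_neutral_cong_right) auto
    also have "\<dots> = of_nat (p ^ n - 1)"
      by (simp add: card_Diff_singleton card_field)
    also have "\<dots> = - 1"
      using of_nat_card_eq_0 p_gt_1 by (simp add: of_nat_diff)
    finally show ?thesis using False True by simp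
  qed
next
  case False
  define r where "r = k mod (p ^ n - 1)"
  have q: "p ^ n - 1 > 0" using p_power_n_gt_1 by simp
  have "0 < r" "r < p ^ n - 1"
    using False q by (auto simp: r_def dvd_eq_mod_eq_0)
  then obtain b :: 'a where b: "b \<noteq> 0" "b ^ r \<noteq> 1"
    using exists_power_neq_1 by blast
  have "b ^ k = b ^ ((p ^ n - 1) * (k div (p ^ n - 1)) + r)"
    by (simp add: r_def)
  also have "\<dots> = b ^ r"
    unfolding power_add power_mult by (simp only: power_card_minus_1 [OF b(1)]) simp
  finally have bk: "b ^ k \<noteq> 1" using b by simp
  \<comment> \<open>The substitution multiplies the sum by \<open>b ^ k\<close>, which is not 1, so
    the sum is 0.\<close>
  have "(\<Sum>x\<in>UNIV. (x :: 'a) ^ k) = (\<Sum>x\<in>UNIV. (b * x) ^ k)"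
    by (rule sum.reindex_bij_witness [of _ "\<lambda>x. b * x" "\<lambda>x. x / b"]) (use b in auto)
  also have "\<dots> = b ^ k * (\<Sum>x\<in>UNIV. x ^ k)"
    by (simp add: power_mult_distrib sum_distrib_left)
  finally show ?thesis using bk False by simp
qed

section \<open>The trace to the prime field\<close>

definition tr :: "'a \<Rightarrow> 'a" where "tr x = (\<Sum>j<n. x ^ (p ^ j))"

lemma tr_add: "tr (x + y) = tr x + tr y"
  by (simp add: tr_def frobenius_add sum.distrib)

lemma tr_0 [simp]: "tr 0 = 0"
  using p_gt_1 by (auto simp: tr_def power_0_left intro!: sum.neutral)

lemma tr_diff: "tr (x - y) = tr x - tr y"
  using tr_add [of "x - y" y] by simp

lemma tr_sum: "tr (sum f A) = (\<Sum>i\<in>A. tr (f i))"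
  by (induction A rule: infinite_finite_induct) (simp_all add: tr_add)

lemma tr_power_p: "tr x ^ p = tr x"
proof -
  have "tr x ^ p = (\<Sum>j<n. x ^ (p ^ Suc j))"
    using frobenius_sum [of "\<lambda>j. x ^ (p ^ j)" "{..<n}" 1]
    by (simp add: tr_def power_mult [symmetric] mult.commute)
  moreover have "(\<Sum>j<Suc n. x ^ (p ^ j)) = x + (\<Sum>j<n. x ^ (p ^ Suc j))"
    by (subst sum.lessThan_Suc_shift) simp
  moreover have "(\<Sum>j<Suc n. x ^ (p ^ j)) = tr x + x"
    by (simp add: tr_def power_card)
  ultimately show ?thesis by simp
qed

text \<open>The \<open>p\<close> multiples of 1 already exhaust the at most \<open>p\<close> roots
  of X ^ p - X.\<close>

lemma fixed_by_frobenius: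
  assumes "(y :: 'a) ^ p = y"
  shows "\<exists>k. of_nat k = y"
proof -
  let ?R = "{x :: 'a. poly (monom 1 p - monom 1 1) x = 0}"
  have deg: "degree (monom 1 p - monom 1 1 :: 'a poly) = p"
    using degree_add_eq_left [of "- monom 1 1" "monom 1 p :: 'a poly"] p_gt_1
    by (simp add: degree_monom_eq)
  hence nz: "monom 1 p - monom 1 1 \<noteq> (0 :: 'a poly)"
    using p_gt_1 by auto
  have inj: "inj_on (of_nat :: nat \<Rightarrow> 'a) {..<p}"
    by (intro inj_onI) (simp add: of_nat_eq_iff_cong_CHAR CHAR_field cong_def)
  have "of_nat ` {..<p} = ?R"
  proof (rule card_seteq)
    show "card ?R \<le> card (of_nat ` {..<p} :: 'a set)"
      using card_poly_roots_bound [OF nz] deg by (simp add: card_image [OF inj])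
  qed (auto simp: poly_monom of_nat_power_p)
  moreover have "y \<in> ?R" using assms by (simp add: poly_monom)
  ultimately show ?thesis by (metis imageE)
qed

text \<open>The trace is given by a non-zero polynomial of degree below q, hence has a non-zero
  value; this value lies in the prime field, so it can be scaled to 1.\<close>

lemma exists_tr_eq_1: "\<exists>z. tr z = 1"
proof -
  define P :: "'a poly" where "P = (\<Sum>j<n. monom 1 (p ^ j))"
  have P: "poly P x = tr x" for x
    by (simp add: P_def tr_def poly_sum poly_monom)
  have "coeff P 1 = (\<Sum>j<n. if j = 0 then 1 else 0)"
    unfolding P_def coeff_sum coeff_monom using p_gt_1 by (intro sum.cong) auto
  hence nz: "P \<noteq> 0" using n_pos by auto
  have "degree P \<le> p ^ (n - 1)"
    unfolding P_def using p_gt_1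
    by (intro degree_sum_le) (auto simp: degree_monom_eq intro!: power_increasing)
  also have "\<dots> < p ^ n" using p_gt_1 n_pos by simp
  finally have "card {x. poly P x = 0} < CARD('a)"
    using card_poly_roots_bound [OF nz] by (simp add: card_field)
  then obtain z where z: "tr z \<noteq> 0"
    by (metis (mono_tags, lifting) P UNIV_I less_irrefl mem_Collect_eq subsetI top.extremum_uniqueI)
  have pow: "tr z ^ (p ^ j) = tr z" for j
    by (induction j) (simp_all add: power_mult tr_power_p)
  have "tr (inverse (tr z) * z) = inverse (tr z) * tr z"
    by (simp add: tr_def [of "inverse (tr z) * z"] power_mult_distrib power_inverse pow
        flip: sum_distrib_left) (simp add: tr_def)
  thus ?thesis using z by auto
qed

text \<open>In the expansion of \<open>\<Sum>b. b ^ e * tr (b * y)\<close> with \<open>e = p ^ n - 1 - p ^ j\<close>, the power sum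
  \<open>\<Sum>b. b ^ (e + p ^ i)\<close> vanishes except for \<open>i = j\<close>.\<close>

lemma frobenius_eq_trace_sum:
  assumes "j < n"
  shows "(y :: 'a) ^ (p ^ j) = - (\<Sum>b\<in>UNIV. b ^ (p ^ n - 1 - p ^ j) * tr (b * y))"
proof -
  define e where "e = p ^ n - 1 - p ^ j"
  have less: "p ^ i < p ^ n" if "i < n" for i using p_gt_1 that by simp
  have sum: "(\<Sum>b\<in>UNIV. (b :: 'a) ^ (e + p ^ i)) = (if i = j then - 1 else 0)" if i: "i < n" for i
  proof (cases "i = j")
    case True
    have "e + p ^ j = p ^ n - 1" using less [OF assms] by (simp add: e_def)
    moreover have "p ^ n - 1 > 0" using p_power_n_gt_1 by simp
    ultimately show ?thesis using True by (simp add: sum_powers_UNIV)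
  next
    case False
    have neq: "p ^ i \<noteq> p ^ j" using False p_gt_1 by simp
    have pos: "p ^ i > 0" "p ^ j > 0" using p_gt_1 by auto
    \<comment> \<open>The exponent lies strictly between 0 and \<open>2 * (p ^ n - 1)\<close> and
      differs from \<open>p ^ n - 1\<close>.\<close>
    have "\<not> p ^ n - 1 dvd e + p ^ i"
    proof
      assume "p ^ n - 1 dvd e + p ^ i"
      then obtain c where c: "e + p ^ i = (p ^ n - 1) * c" by (elim dvdE)
      have "c \<noteq> 0" using c pos by (intro notI) simp
      moreover have "c \<noteq> 1" using c neq less [OF assms] by (intro notI) (simp add: e_def)
      ultimately have "c \<ge> 2" by simp
      hence "(p ^ n - 1) * 2 \<le> e + p ^ i" unfolding c by (rule mult_le_mono2)
      thus False using less [OF i] less [OF assms] pos unfolding e_def by linarith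
    qed
    thus ?thesis using False by (simp add: sum_powers_UNIV)
  qed
  have "(\<Sum>b\<in>UNIV. b ^ e * tr (b * y)) = (\<Sum>b\<in>UNIV. \<Sum>i<n. y ^ (p ^ i) * b ^ (e + p ^ i))"
    by (simp add: tr_def sum_distrib_left power_mult_distrib power_add mult_ac)
  also have "\<dots> = (\<Sum>i<n. y ^ (p ^ i) * (\<Sum>b\<in>UNIV. b ^ (e + p ^ i)))"
    by (subst sum.swap) (simp add: sum_distrib_left)
  also have "\<dots> = (\<Sum>i<n. if i = j then - (y ^ (p ^ j)) else 0)"
    by (intro sum.cong) (simp_all add: sum)
  also have "\<dots> = - (y ^ (p ^ j))" using assms by simp
  finally show ?thesis by (simp add: e_def)
qed

section \<open>Additive character sums\<close>

text \<open>An arbitrary natural representative; only its class modulo \<open>p\<close> is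
  determined.\<close>

definition tr_nat :: "'a \<Rightarrow> nat" where "tr_nat x = (SOME k. of_nat k = tr x)"

lemma of_nat_tr_nat [simp]: "of_nat (tr_nat x) = tr x"
  unfolding tr_nat_def using fixed_by_frobenius [OF tr_power_p] by (rule someI_ex)

text \<open>The canonical additive character. On these representatives the homomorphism laws are
  congruences modulo \<open>cyc_poly p\<close>.\<close>

definition chi :: "'a \<Rightarrow> int poly" where "chi x = X_poly ^ tr_nat x"

lemma cyc_dvd_chi_diff:
  assumes "of_nat k = tr x"
  shows "cyc_poly p dvd X_poly ^ k - chi x"
proof -
  have "of_nat k = (of_nat (tr_nat x) :: 'a)" using assms by simp
  thus ?thesis
    unfolding chi_def by (intro cyc_dvd_X_power_diff) (simp only: of_nat_eq_iff_cong_CHAR CHAR_field)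
qed

text \<open>Orthogonality: a shift by an element of trace 1 multiplies the full sum by \<zeta>, so
  \<pi> times the sum is 0, and \<pi> cancels.\<close>

lemma cyc_dvd_chi_sum:
  assumes "b \<noteq> 0"
  shows "cyc_poly p dvd (\<Sum>z\<in>UNIV. chi (c + b * z))"
proof -
  define S where "S = (\<Sum>z\<in>UNIV. chi z)"
  obtain z0 where z0: "tr z0 = 1" using exists_tr_eq_1 by blast
  have shift: "S = (\<Sum>z\<in>UNIV. chi (z + z0))"
    unfolding S_def
    by (rule sum.reindex_bij_witness [of _ "\<lambda>x. x + z0" "\<lambda>x. x - z0"]) auto
  have "pi_poly * S = (\<Sum>z\<in>UNIV. X_poly ^ Suc (tr_nat z)) - S"
    by (simp add: S_def pi_poly_def chi_def left_diff_distrib sum_distrib_left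
        sum_subtractf del: mult_pCons_left)
  hence "pi_poly * S = (\<Sum>z\<in>UNIV. X_poly ^ Suc (tr_nat z) - chi (z + z0))"
    unfolding sum_subtractf shift [symmetric] .
  also have "cyc_poly p dvd \<dots>"
    by (intro dvd_sum cyc_dvd_chi_diff) (simp add: tr_add z0)
  finally have "cyc_poly p dvd S"
    using p_gt_1 by (intro cyc_dvd_pi_mult_cancel [of p S]) auto
  also have "S = (\<Sum>z\<in>UNIV. chi (c + b * z))"
    unfolding S_def
    by (rule sum.reindex_bij_witness [of _ "\<lambda>z. c + b * z" "\<lambda>z. (z - c) / b"]) (use assms in auto)
  finally show ?thesis .
qed

lemma cyc_dvd_chi_conj: "cyc_poly p dvd chi x * conj_poly p (chi y) - chi (x - y)"
proof -
  have "of_nat (tr_nat x + (p - 1) * tr_nat y) = tr (x - y)"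
    using p_gt_1 by (simp add: of_nat_diff tr_diff)
  from cyc_dvd_chi_diff [OF this] show ?thesis
    by (simp add: chi_def conj_X_power power_add)
qed

text \<open>\<open>tr_nat 0\<close> may be any multiple of \<open>p\<close>, hence a congruence in
  place of \<open>chi 0 = 1\<close>.\<close>

lemma cyc_dvd_chi_0: "cyc_poly p dvd 1 - chi 0"
  using cyc_dvd_chi_diff [of 0 0] by simp

text \<open>Expand the norm into a double sum of \<open>chi (h x - h y)\<close> and put x = y + u.
  For u \<noteq> 0 planarity makes the argument run through the whole field, so by orthogonality
  only u = 0 remains, contributing q.\<close>

lemma cyc_dvd_character_norm:
  fixes a b :: 'a
  assumes "planar F" "b \<noteq> 0"
  defines "w \<equiv> (\<Sum>x\<in>UNIV. chi (a * x + b * F x))"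
  shows "cyc_poly p dvd w * conj_poly p w - of_nat p ^ n"
proof -
  define h where "h x = a * x + b * F x" for x
  define T where "T u = (\<Sum>y\<in>UNIV. chi (h (y + u) - h y))" for u
  have "w * conj_poly p w = (\<Sum>x\<in>UNIV. \<Sum>y\<in>UNIV. chi (h x) * conj_poly p (chi (h y)))"
    by (simp add: w_def h_def conj_sum sum_product)
  hence "w * conj_poly p w - (\<Sum>x\<in>UNIV. \<Sum>y\<in>UNIV. chi (h x - h y)) =
      (\<Sum>x\<in>UNIV. \<Sum>y\<in>UNIV. chi (h x) * conj_poly p (chi (h y)) - chi (h x - h y))"
    by (simp add: sum_subtractf)
  also have "cyc_poly p dvd \<dots>"
    by (intro dvd_sum cyc_dvd_chi_conj)
  finally have 1: "cyc_poly p dvd w * conj_poly p w - (\<Sum>x\<in>UNIV. \<Sum>y\<in>UNIV. chi (h x - h y))" .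
  have "(\<Sum>x\<in>UNIV. \<Sum>y\<in>UNIV. chi (h x - h y)) = (\<Sum>y\<in>UNIV. \<Sum>x\<in>UNIV. chi (h x - h y))"
    by (rule sum.swap)
  also have "\<dots> = (\<Sum>y\<in>UNIV. \<Sum>u\<in>UNIV. chi (h (y + u) - h y))"
  proof (rule sum.cong [OF refl])
    fix y
    show "(\<Sum>x\<in>UNIV. chi (h x - h y)) = (\<Sum>u\<in>UNIV. chi (h (y + u) - h y))"
      by (rule sum.reindex_bij_witness [of _ "\<lambda>u. y + u" "\<lambda>x. x - y"]) auto
  qed
  also have "\<dots> = (\<Sum>u\<in>UNIV. T u)"
    unfolding T_def by (rule sum.swap)
  also have "\<dots> = T 0 + (\<Sum>u\<in>UNIV - {0}. T u)"
    by (rule sum.remove) auto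
  finally have 2: "(\<Sum>x\<in>UNIV. \<Sum>y\<in>UNIV. chi (h x - h y)) = T 0 + (\<Sum>u\<in>UNIV - {0}. T u)" .
  have "cyc_poly p dvd T u" if "u \<noteq> 0" for u
  proof -
    have "bij (\<lambda>x. F (x + u) - F x - F u)"
      using assms(1) that unfolding planar_def by blast
    hence "(\<Sum>z\<in>UNIV. chi ((a * u + b * F u) + b * z)) =
        (\<Sum>y\<in>UNIV. chi ((a * u + b * F u) + b * (F (y + u) - F y - F u)))"
      by (rule sum.reindex_bij_betw [symmetric])
    also have "\<dots> = T u"
      by (simp add: T_def h_def algebra_simps)
    finally show ?thesis using cyc_dvd_chi_sum [OF assms(2)] by metis
  qed
  hence 3: "cyc_poly p dvd (\<Sum>u\<in>UNIV - {0}. T u)"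
    by (intro dvd_sum) auto
  have "T 0 = of_nat p ^ n * chi 0"
    by (simp add: T_def card_field)
  hence "w * conj_poly p w - of_nat p ^ n =
      (w * conj_poly p w - (\<Sum>x\<in>UNIV. \<Sum>y\<in>UNIV. chi (h x - h y)))
      + (\<Sum>u\<in>UNIV - {0}. T u) - of_nat p ^ n * (1 - chi 0)"
    unfolding 2 by (simp add: algebra_simps)
  also have "cyc_poly p dvd \<dots>"
    by (rule dvd_diff [OF dvd_add [OF 1 3] dvd_mult [OF cyc_dvd_chi_0]])
  finally show ?thesis .
qed

lemma character_sum_in_pi_power:
  assumes "planar F" "2 * d < n * (p - 1)"
  shows "in_pi_power p (Suc d) (\<Sum>x\<in>UNIV. chi (a * x + b * F x))"
proof (cases "b = 0")
  case False
  show ?thesis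
    using assms(2)
    by (intro in_pi_power_of_norm [OF prime_p cyc_dvd_character_norm [OF assms(1) False]]) simp
next
  case b: True
  show ?thesis
  proof (cases "a = 0")
    case True
    have "in_pi_power p (n * (p - 1)) (of_nat p ^ n * chi 0)"
      using in_pi_power_mult_left [OF in_pi_power_prime_power [OF prime_p], where f = "chi 0"]
      by (simp add: mult.commute)
    thus ?thesis
      using assms(2) in_pi_power_mono [of p "n * (p - 1)" _ "Suc d"]
      by (simp add: b True card_field)
  next
    case False
    thus ?thesis
      using cyc_dvd_chi_sum [of a 0] by (intro in_pi_power_cyc_dvd) (simp add: b)
  qed
qed

section \<open>Sums of products of traces and of Frobenius powers\<close>

lemma trace_product_sum_eq_0:
  assumes "planar F" "2 * d < n * (p - 1)"
  shows "(\<Sum>x\<in>UNIV. \<Prod>i<d. tr (a i * x + b i * F x)) = 0"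
proof -
  define t where "t i x = tr_nat (a i * x + b i * F x)" for i x
  \<comment> \<open>Each \<open>X_poly ^ t i x - 1\<close> is \<pi> times a geometric sum whose
    value at 1 is \<open>t i x\<close>; \<open>g\<close> is built from these cofactors.\<close>
  define g where "g = (\<Sum>x\<in>UNIV. \<Prod>i<d. \<Sum>j<t i x. X_poly ^ j)"
  have "pi_poly ^ d * g = (\<Sum>x\<in>UNIV. \<Prod>i<d. X_poly ^ t i x - 1)"
    unfolding g_def X_power_diff_1 prod.distrib by (simp add: sum_distrib_left)
  also have "\<dots> = (\<Sum>x\<in>UNIV. \<Sum>I\<in>Pow {..<d}. (-1) ^ (d - card I) * (\<Prod>i\<in>I. X_poly ^ t i x))"
    by (subst prod_diff_conv_sum') simp_all
  also have "\<dots> = (\<Sum>I\<in>Pow {..<d}. (-1) ^ (d - card I) * (\<Sum>x\<in>UNIV. \<Prod>i\<in>I. X_poly ^ t i x))"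
    by (subst sum.swap) (simp add: sum_distrib_left)
  also have "in_pi_power p (Suc d) \<dots>"
  proof (rule in_pi_power_sum, rule in_pi_power_mult_left)
    fix I
    let ?A = "\<Sum>i\<in>I. a i" and ?B = "\<Sum>i\<in>I. b i"
    \<comment> \<open>A product of characters is the character of the summed arguments, so each
      \<open>I\<close> yields a single character sum.\<close>
    have "cyc_poly p dvd (\<Prod>i\<in>I. X_poly ^ t i x) - chi (?A * x + ?B * F x)" for x
    proof -
      have "of_nat (\<Sum>i\<in>I. t i x) = tr (?A * x + ?B * F x)"
        by (simp add: t_def sum_distrib_right flip: tr_sum sum.distrib)
      from cyc_dvd_chi_diff [OF this] show ?thesis by (simp add: power_sum)
    qed
    hence "cyc_poly p dvd
        (\<Sum>x\<in>UNIV. (\<Prod>i\<in>I. X_poly ^ t i x) - chi (?A * x + ?B * F x))"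
      by (intro dvd_sum)
    hence "cyc_poly p dvd (\<Sum>x\<in>UNIV. \<Prod>i\<in>I. X_poly ^ t i x) - (\<Sum>x\<in>UNIV. chi (?A * x + ?B * F x))"
      by (simp only: sum_subtractf)
    thus "in_pi_power p (Suc d) (\<Sum>x\<in>UNIV. \<Prod>i\<in>I. X_poly ^ t i x)"
      using character_sum_in_pi_power [OF assms] by (rule in_pi_power_cong)
  qed
  finally have "int p dvd poly g 1"
    using p_gt_1 by (intro in_pi_power_prime_dvd [of p "Suc d" d]) auto
  hence "int p dvd int (\<Sum>x\<in>UNIV. \<Prod>i<d. t i x)"
    by (simp add: g_def poly_sum poly_prod poly_power)
  hence "of_nat (\<Sum>x\<in>UNIV. \<Prod>i<d. t i x) = (0 :: 'a)"
    unfolding int_dvd_int_iff of_nat_eq_0_iff_char_dvd CHAR_field .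
  thus ?thesis by (simp add: t_def)
qed

text \<open>Induction trading one Frobenius power in \<open>ls\<close> for one trace in
  \<open>ts\<close>, with the total number of factors fixed. The scalar b of the trace formula is
  absorbed into the linear form.\<close>

lemma frobenius_product_sum_eq_0:
  assumes "planar F" "2 * (length ls + length ts) < n * (p - 1)"
    and "\<And>c d j. (c, d, j) \<in> set ls \<Longrightarrow> j < n"
  shows "(\<Sum>x\<in>UNIV. (\<Prod>(c, d, j)\<leftarrow>ls. (c * x + d * F x) ^ (p ^ j)) *
    (\<Prod>(a, b)\<leftarrow>ts. tr (a * x + b * F x))) = 0"
  using assms(2,3)
proof (induction ls arbitrary: ts)
  case Nil
  have "(\<Prod>(a, b)\<leftarrow>ts. tr (a * x + b * F x)) =
      (\<Prod>i<length ts. tr (fst (ts ! i) * x + snd (ts ! i) * F x))" for x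
    by (simp add: prod.list_conv_set_nth case_prod_beta atLeast0LessThan)
  thus ?case
    using trace_product_sum_eq_0 [OF assms(1), of "length ts" "\<lambda>i. fst (ts ! i)" "\<lambda>i. snd (ts ! i)"]
      Nil by simp
next
  case (Cons l ls)
  obtain c d j where l: "l = (c, d, j)" by (cases l)
  hence j: "j < n" using Cons.prems(2) by auto
  define e where "e = p ^ n - 1 - p ^ j"
  let ?L = "\<lambda>x. \<Prod>(c, d, j)\<leftarrow>ls. (c * x + d * F x) ^ (p ^ j)"
  let ?T = "\<lambda>ts x. \<Prod>(a, b)\<leftarrow>ts. tr (a * x + b * F x)"
  have "(\<Prod>(c, d, j)\<leftarrow>l # ls. (c * x + d * F x) ^ (p ^ j)) * ?T ts x =
      - (\<Sum>b\<in>UNIV. b ^ e * (?L x * ?T ((b * c, b * d) # ts) x))" for x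
  proof -
    have "(\<Prod>(c, d, j)\<leftarrow>l # ls. (c * x + d * F x) ^ (p ^ j)) * ?T ts x =
      - (\<Sum>b\<in>UNIV. b ^ e * tr (b * (c * x + d * F x))) * (?L x * ?T ts x)"
      using frobenius_eq_trace_sum [OF j, of "c * x + d * F x"] by (simp add: l e_def)
    thus ?thesis
      by (simp add: sum_distrib_left sum_distrib_right algebra_simps)
  qed
  hence "(\<Sum>x\<in>UNIV. (\<Prod>(c, d, j)\<leftarrow>l # ls. (c * x + d * F x) ^ (p ^ j)) * ?T ts x) =
      - (\<Sum>x\<in>UNIV. \<Sum>b\<in>UNIV. b ^ e * (?L x * ?T ((b * c, b * d) # ts) x))"
    by (simp only: sum_negf)
  also have "\<dots> = - (\<Sum>b\<in>UNIV. b ^ e * (\<Sum>x\<in>UNIV. ?L x * ?T ((b * c, b * d) # ts) x))"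
    by (subst sum.swap) (simp only: sum_distrib_left)
  also have "\<dots> = - (\<Sum>b\<in>UNIV. b ^ e * 0)"
    using Cons.prems
    by (intro arg_cong [of _ _ uminus] sum.cong refl arg_cong2 [of _ _ _ _ "(*)"] Cons.IH) auto
  finally show ?case by simp
qed

end

section \<open>Digit sums\<close>

lemma digit_sum_eq:
  assumes "p > 1" "e < m"
  shows "digit_sum p e = (\<Sum>i<m. (e div p ^ i) mod p)"
  unfolding digit_sum_def
proof (rule sum.mono_neutral_left)
  show "\<forall>i\<in>{..<m} - {..e}. e div p ^ i mod p = 0"
  proof
    fix i assume "i \<in> {..<m} - {..e}"
    hence "e < i" by simp
    also have "i < p ^ i" using assms(1) by (simp add: power_gt_expt)
    finally show "e div p ^ i mod p = 0" by simp
  qed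
qed (use assms(2) in auto)

lemma digit_sum_rec:
  assumes "p > 1"
  shows "digit_sum p e = e mod p + digit_sum p (e div p)"
proof -
  \<comment> \<open>After the lowest position is split off, \<open>Suc e\<close> positions remain,
    enough for \<open>e div p\<close>.\<close>
  have "digit_sum p e = (\<Sum>i<Suc (Suc e). (e div p ^ i) mod p)"
    using assms by (intro digit_sum_eq) auto
  also have "\<dots> = e mod p + (\<Sum>i<Suc e. (e div p div p ^ i) mod p)"
    by (subst sum.lessThan_Suc_shift) (simp add: div_mult2_eq)
  also have "(\<Sum>i<Suc e. (e div p div p ^ i) mod p) = digit_sum p (e div p)"
    using assms by (intro digit_sum_eq [symmetric]) (auto simp: le_imp_less_Suc)
  finally show ?thesis .
qed

lemma digit_sum_0 [simp]: "digit_sum p 0 = 0"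
  by (simp add: digit_sum_def)

text \<open>The list contains each position as often as its digit says. Thus an e-th power is a
  product of \<open>digit_sum p e\<close> Frobenius powers.\<close>

lemma digit_sum_powers:
  assumes "p > 1"
  shows "\<exists>js. length js = digit_sum p e \<and> (\<Sum>j\<leftarrow>js. p ^ j) = e"
proof (induction e rule: less_induct)
  case (less e)
  show ?case
  proof (cases "e = 0")
    case False
    hence "e div p < e" using assms by simp
    then obtain js where js: "length js = digit_sum p (e div p)" "(\<Sum>j\<leftarrow>js. p ^ j) = e div p"
      using less by blast
    have "(\<Sum>j\<leftarrow>map Suc js. p ^ j) = p * (\<Sum>j\<leftarrow>js. p ^ j)"
      by (simp add: sum_list_const_mult o_def)
    hence "(\<Sum>j\<leftarrow>replicate (e mod p) 0 @ map Suc js. p ^ j) = e"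
      by (simp add: js sum_list_replicate)
    moreover have "length (replicate (e mod p) 0 @ map Suc js) = digit_sum p e"
      using digit_sum_rec [OF assms, of e] by (simp add: js)
    ultimately show ?thesis by blast
  qed simp
qed

text \<open>All n digits of \<open>p ^ n - 1\<close> are \<open>p - 1\<close>, so the subtraction
  needs no borrow and complements each digit.\<close>

lemma digit_sum_complement:
  assumes "p > 1" "i < p ^ n"
  shows "digit_sum p (p ^ n - 1 - i) + digit_sum p i = n * (p - 1)"
  using assms(2)
proof (induction n arbitrary: i)
  case (Suc n)
  have "i div p < p ^ n"
    using Suc.prems assms(1) by (simp add: less_mult_imp_div_less mult.commute)
  then obtain a where a: "p ^ n = Suc (i div p + a)"
    using less_iff_Suc_add by blast
  have "i mod p < p" using assms(1) by simp
  have "p ^ Suc n = p * (i div p) + p * a + p"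
    by (simp add: a algebra_simps)
  moreover have "i = p * (i div p) + i mod p" by simp
  ultimately have "p ^ Suc n - 1 - i = (p - 1 - i mod p) + p * a"
    using \<open>i mod p < p\<close> by linarith
  hence "p ^ Suc n - 1 - i = (p - 1 - i mod p) + p * (p ^ n - 1 - i div p)"
    by (simp add: a)
  hence "(p ^ Suc n - 1 - i) mod p = p - 1 - i mod p" "(p ^ Suc n - 1 - i) div p = p ^ n - 1 - i div p"
    using assms(1) by auto
  thus ?case
    using Suc.IH [OF \<open>i div p < p ^ n\<close>] digit_sum_rec [OF assms(1), of "p ^ Suc n - 1 - i"]
      digit_sum_rec [OF assms(1), of i] \<open>i mod p < p\<close> by simp
qed simp

section \<open>The degree bound\<close>

context finite_field_of_order
begin

text \<open>Both powers are products of Frobenius powers, of x (coefficients 1, 0) and of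
  \<open>F x\<close> (coefficients 0, 1); the two digit sums count the factors.\<close>

lemma monomial_sum_eq_0:
  assumes "planar F" "A < p ^ n" "B < p ^ n" "2 * (digit_sum p A + digit_sum p B) < n * (p - 1)"
  shows "(\<Sum>x\<in>UNIV. x ^ A * F x ^ B) = (0 :: 'a)"
proof -
  obtain js ks where js: "length js = digit_sum p A" "(\<Sum>j\<leftarrow>js. p ^ j) = A"
    and ks: "length ks = digit_sum p B" "(\<Sum>j\<leftarrow>ks. p ^ j) = B"
    using digit_sum_powers [OF p_gt_1] by metis
  have bound: "j < n" if "(\<Sum>j\<leftarrow>js. p ^ j) < p ^ n" "j \<in> set js" for j js
  proof -
    have "p ^ j \<le> (\<Sum>j\<leftarrow>js. p ^ j)" using that(2) by (intro member_le_sum_list) auto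
    with that(1) have "p ^ j < p ^ n" by simp
    thus ?thesis using p_gt_1 by simp
  qed
  have pow: "(\<Prod>j\<leftarrow>js. y ^ (p ^ j)) = y ^ (\<Sum>j\<leftarrow>js. p ^ j)" for y :: 'a and js
    by (induction js) (simp_all add: power_add)
  define ls where "ls = map (\<lambda>j. (1 :: 'a, 0 :: 'a, j)) js @ map (\<lambda>j. (0, 1, j)) ks"
  have "(\<Prod>(c, d, j)\<leftarrow>ls. (c * x + d * F x) ^ (p ^ j)) = x ^ A * F x ^ B" for x
    using pow [of x js] pow [of "F x" ks] by (simp add: ls_def o_def js ks)
  moreover have "j < n" if "(c, d, j) \<in> set ls" for c d j
    using that bound [of js j] bound [of ks j] assms(2,3) by (auto simp: ls_def js ks)
  ultimately show ?thesis
    using frobenius_product_sum_eq_0 [OF assms(1), of ls "[]"] assms(4)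
    by (simp add: ls_def js ks)
qed

section \<open>Coefficients of interpolating polynomials and the algebraic degree\<close>

lemma interp_poly_props:
  fixes H :: "'a \<Rightarrow> 'a"
  shows "degree (interp_poly H) < p ^ n" "poly (interp_poly H) x = H x"
  using theI' [OF interp_poly_ex1 [of H]] by (auto simp: interp_poly_def card_field)

lemma interp_poly_sum:
  fixes H :: "'a \<Rightarrow> 'a"
  shows "H x = (\<Sum>k<p ^ n. coeff (interp_poly H) k * x ^ k)"
proof -
  have "H x = (\<Sum>k\<le>degree (interp_poly H). coeff (interp_poly H) k * x ^ k)"
    using interp_poly_props(2) [of H x] by (simp add: poly_altdef)
  also have "\<dots> = (\<Sum>k<p ^ n. coeff (interp_poly H) k * x ^ k)"
    using interp_poly_props(1) [of H] by (intro sum.mono_neutral_left) (auto simp: coeff_eq_0)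
  finally show ?thesis .
qed

text \<open>The power sum of exponent \<open>p ^ n - 1 - i + k\<close> isolates k = i. For i = 0 the
  index k = p ^ n - 1 would contribute as well.\<close>

lemma coeff_interp_poly:
  fixes H :: "'a \<Rightarrow> 'a"
  assumes "0 < i" "i < p ^ n"
  shows "coeff (interp_poly H) i = - (\<Sum>x\<in>UNIV. x ^ (p ^ n - 1 - i) * H x)"
proof -
  let ?h = "coeff (interp_poly H)" and ?r = "p ^ n - 1 - i"
  have sum: "(\<Sum>x\<in>UNIV. (x :: 'a) ^ (?r + k)) = (if k = i then - 1 else 0)" if k: "k < p ^ n" for k
  proof (cases "k = i")
    case True
    thus ?thesis using assms p_power_n_gt_1 by (simp add: sum_powers_UNIV)
  next
    case False
    have "\<not> (?r + k > 0 \<and> p ^ n - 1 dvd ?r + k)"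
    proof
      assume *: "?r + k > 0 \<and> p ^ n - 1 dvd ?r + k"
      then obtain c where c: "?r + k = (p ^ n - 1) * c" by (elim conjE dvdE)
      have "c \<noteq> 0" using c * by (intro notI) simp
      moreover have "c \<noteq> 1" using c False assms by (intro notI) simp
      ultimately have "c \<ge> 2" by simp
      hence "(p ^ n - 1) * 2 \<le> ?r + k" unfolding c by (rule mult_le_mono2)
      thus False using k assms by simp
    qed
    thus ?thesis using False by (simp only: sum_powers_UNIV if_False)
  qed
  have "(\<Sum>x\<in>UNIV. x ^ ?r * H x) = (\<Sum>x\<in>UNIV. \<Sum>k<p ^ n. ?h k * x ^ (?r + k))"
    by (subst interp_poly_sum [of H]) (simp add: sum_distrib_left power_add mult_ac)
  also have "\<dots> = (\<Sum>k<p ^ n. ?h k * (\<Sum>x\<in>UNIV. x ^ (?r + k)))"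
    by (subst sum.swap) (simp add: sum_distrib_left)
  also have "\<dots> = (\<Sum>k<p ^ n. if k = i then - ?h i else 0)"
  proof (rule sum.cong [OF refl])
    fix k assume "k \<in> {..<p ^ n}"
    hence "k < p ^ n" by simp
    thus "?h k * (\<Sum>x\<in>UNIV. x ^ (?r + k)) = (if k = i then - ?h i else 0)"
      by (subst sum) simp_all
  qed
  also have "\<dots> = - ?h i" using assms by simp
  finally show ?thesis by simp
qed

lemma digit_sum_le_alg_degree:
  assumes "coeff (interp_poly (G :: 'a \<Rightarrow> 'a)) i \<noteq> 0"
  shows "digit_sum p i \<le> alg_degree p G"
proof -
  let ?S = "{digit_sum p i | i. coeff (interp_poly G) i \<noteq> 0}"
  have "?S \<subseteq> digit_sum p ` {..degree (interp_poly G)}"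
    by (auto intro: le_degree)
  hence "finite ?S" by (rule finite_subset) simp
  hence "digit_sum p i \<le> Max ?S"
    using assms by (intro Max_ge) auto
  \<comment> \<open>Rules out the default value 0 of \<open>alg_degree\<close> at the zero
    function.\<close>
  moreover have "G \<noteq> (\<lambda>_. 0)"
  proof
    assume "G = (\<lambda>_. 0)"
    hence "interp_poly G = 0"
      unfolding interp_poly_def by (intro the1_equality [OF interp_poly_ex1]) auto
    thus False using assms by simp
  qed
  ultimately show ?thesis by (simp add: alg_degree_def)
qed

lemma alg_degree_attained:
  assumes "H \<noteq> (\<lambda>_. 0 :: 'a)"
  shows "\<exists>i. coeff (interp_poly H) i \<noteq> 0 \<and> digit_sum p i = alg_degree p H"
proof -
  let ?S = "{digit_sum p i | i. coeff (interp_poly H) i \<noteq> 0}"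
  have "?S \<subseteq> digit_sum p ` {..degree (interp_poly H)}"
    by (auto intro: le_degree)
  hence fin: "finite ?S" by (rule finite_subset) simp
  have "interp_poly H \<noteq> 0"
    using assms interp_poly_props(2) [of H] by (metis ext poly_0)
  hence "coeff (interp_poly H) (degree (interp_poly H)) \<noteq> 0" by simp
  hence "?S \<noteq> {}" by blast
  from Max_in [OF fin this] show ?thesis using assms by (auto simp: alg_degree_def)
qed

lemma alg_degree_comp_planar:
  fixes F G :: "'a \<Rightarrow> 'a"
  assumes "planar F"
  shows "2 * alg_degree p (G \<circ> F) \<le> 2 * alg_degree p G + n * (p - 1)"
proof (cases "G \<circ> F = (\<lambda>_. 0)")
  case True
  \<comment> \<open>\<open>G \<circ> F\<close> can vanish even if \<open>G\<close> does not; its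
    degree is then 0 by convention.\<close>
  thus ?thesis by (simp add: alg_degree_def)
next
  case False
  then obtain i where i: "coeff (interp_poly (G \<circ> F)) i \<noteq> 0"
    and deg: "digit_sum p i = alg_degree p (G \<circ> F)"
    using alg_degree_attained by blast
  show ?thesis
  proof (rule ccontr)
    assume gt: "\<not> ?thesis"
    have i0: "0 < i" using gt deg by (intro gr0I) simp
    have "i \<le> degree (interp_poly (G \<circ> F))" using i by (rule le_degree)
    hence iq: "i < p ^ n" using interp_poly_props(1) [of "G \<circ> F"] by simp
    let ?r = "p ^ n - 1 - i" and ?g = "coeff (interp_poly G)"
    have "(\<Sum>x\<in>UNIV. x ^ ?r * (G \<circ> F) x) = (\<Sum>x\<in>UNIV. \<Sum>k<p ^ n. ?g k * (x ^ ?r * F x ^ k))"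
      unfolding o_def by (subst interp_poly_sum [of G]) (simp add: sum_distrib_left mult_ac)
    also have "\<dots> = (\<Sum>k<p ^ n. ?g k * (\<Sum>x\<in>UNIV. x ^ ?r * F x ^ k))"
      by (subst sum.swap) (simp add: sum_distrib_left)
    also have "\<dots> = 0"
    proof (intro sum.neutral ballI)
      fix k assume k: "k \<in> {..<p ^ n}"
      show "?g k * (\<Sum>x\<in>UNIV. x ^ ?r * F x ^ k) = 0"
      proof (cases "?g k = 0")
        case False
        \<comment> \<open>With s the digit sum of \<open>i\<close>, that of \<open>?r\<close> is n(p
          - 1) - s. As 2s exceeds \<open>2 * alg_degree p G + n * (p - 1)\<close>, twice the total
          digit sum of \<open>?r\<close> and \<open>k\<close> stays below n(p - 1).\<close>
        have "(\<Sum>x\<in>UNIV. x ^ ?r * F x ^ k) = 0"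
          using k digit_sum_complement [OF p_gt_1 iq] digit_sum_le_alg_degree [OF False] gt deg iq
          by (intro monomial_sum_eq_0 [OF assms]) auto
        thus ?thesis by simp
      qed simp
    qed
    finally show False
      using coeff_interp_poly [OF i0 iq, of "G \<circ> F"] i by simp
  qed
qed

end

theorem theorem1:
  fixes F :: "'a :: {field, finite} \<Rightarrow> 'a" and p n :: nat
  assumes "prime p" and "n > 0" and "CARD('a) = p ^ n"
    and "planar F"
  shows "\<forall>G :: 'a \<Rightarrow> 'a. G \<noteq> (\<lambda>_. 0) \<longrightarrow>
    real (alg_degree p (G \<circ> F)) - real (alg_degree p G) \<le> real n * (real p - 1) / 2"
proof (intro allI impI)
  fix G :: "'a \<Rightarrow> 'a"
  interpret finite_field_of_order p n "TYPE('a)"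
    by unfold_locales (fact assms)+
  have "real (2 * alg_degree p (G \<circ> F)) \<le> real (2 * alg_degree p G + n * (p - 1))"
    using alg_degree_comp_planar [OF assms(4)] by (simp only: of_nat_le_iff)
  thus "real (alg_degree p (G \<circ> F)) - real (alg_degree p G) \<le> real n * (real p - 1) / 2"
    using p_gt_1 by (simp add: of_nat_diff)
qed

end
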